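(* Let $0<a_1<a_2$ and let $\mathcal{B}\subset\mathbb{R}^3$ be the set of all permutations of $(a_1,\,a_2+1/2,\,2a_2)$. If $(b_1,b_2,b_3)\in\boldsymbol{\Gamma}_+(\mathcal{B})$, then $$\Phi(x)={}_2F_3\left[\begin{array}{c} a_1,a_2\\ b_1,b_2,b_3\end{array}\biggr|\,-x^2\right]\ge 0\quad\text{for all } x>0,$$ and the strict inequality $\Phi(x)>0$ holds for all $x>0$ unless $(b_1,b_2,b_3)\in\mathcal{B}$.
   Context: Notation: ${}_2F_3\left[\begin{array}{c} a_1,a_2\\ b_1,b_2,b_3\end{array}\big|\,z\right]=\sum_{n=0}^\infty\frac{(a_1)_n(a_2)_n}{n!\,(b_1)_n(b_2)_n(b_3)_n}z^n$, where $(\alpha)_n=\alpha(\alpha+1)\cdots(\alpha+n-1)$ and $(\alpha)_0=1$. $\mathbb{R}_+=[0,\infty)$. For a set $E\subset\mathbb{R}_+^3$, the Newton polyhedron $\boldsymbol{\Gamma}_+(E)$ is the convex hull of $\bigcup_{\mathbf{x}\in E}(\mathbf{x}+\mathbb{R}_+^3)$. *)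

theory Defs
  imports "HOL-Analysis.Analysis" "HOL-Combinatorics.Permutations"
begin

text \<open>
  The value at \<open>z\<close> of the generalized hypergeometric series with numerator parameters
  \<open>as\<close> and denominator parameters \<open>bs\<close>; the third argument of \<^const>\<open>fps_hypergeo\<close> is a
  rescaling of the variable, hence \<open>1\<close>. The series is meaningful when it converges at \<open>z\<close>
  (always the case for \<open>length as \<le> length bs\<close>) and no element of \<open>bs\<close> is a non-positive
  integer, as division by zero yields zero.
\<close>
definition hypergeo :: "real list \<Rightarrow> real list \<Rightarrow> real \<Rightarrow> real" where
  "hypergeo as bs z = eval_fps (fps_hypergeo as bs 1) z"

lemma hypergeo_2_3:
  "hypergeo [a1, a2] [b1, b2, b3] z =
     (\<Sum>n. pochhammer a1 n * pochhammer a2 n /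
            (fact n * pochhammer b1 n * pochhammer b2 n * pochhammer b3 n) * z ^ n)"
  by (simp add: hypergeo_def eval_fps_def mult_ac)

definition newton_polyhedron :: "(real ^ 'n) set \<Rightarrow> (real ^ 'n) set" where
  "newton_polyhedron E = convex hull (\<Union>x\<in>E. (\<lambda>y. x + y) ` {y. \<forall>i. 0 \<le> y $ i})"

definition coordinate_permutations :: "'a ^ 'n \<Rightarrow> ('a ^ 'n) set" where
  "coordinate_permutations v = {\<chi> i. v $ p i | p. p permutes UNIV}"

end

theory Submission
  imports Defs "HOL-Real_Asymp.Real_Asymp"
begin

text \<open>
  At a vertex the parameter \<open>a1\<close> cancels and \<open>\<Phi>\<close> is the square of a \<open>0F1\<close> series. Membership in
  the Newton polyhedron says that \<open>(b1, b2, b3)\<close> is weakly majorized by the vertices, so it is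
  reached from a vertex by finitely many moves of two kinds, both of which turn a nonnegative
  function with value \<open>1\<close> at the origin into a strictly positive one:
  raising one denominator parameter, which is a Beta integral transform, and replacing a pair
  \<open>(p, p + d + e)\<close> by \<open>(p + d, p + e)\<close>. By Gauss' summation theorem
  \[ \frac{(p)_n (q)_n}{(p+d)_n (p+e)_n} = \frac{1}{F(q)} \sum_k \frac{(d)_k (e)_k}{k!\,(q)_k}
     \frac{(q)_n}{(q+k)_n}, \qquad q = p + d + e,\quad F(q) = \sum_k \frac{(d)_k (e)_k}{k!\,(q)_k}, \]
  so the second move is a positive combination of the functions with parameters \<open>(p, q + k)\<close>,
  which are already known to be nonnegative, and positive for \<open>k > 0\<close>.
\<close>

section \<open>Entire series that are nonnegative or positive on the negative half-line\<close>

text \<open>All Pochhammer factors are packed into \<open>u\<close>, so a change of parameters is a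
  change of sequence. Convergence everywhere is carried along because both moves exchange a limit
  with the series, and \<open>u 0\<close>, the value at the origin, is what makes raising a
  parameter strict.\<close>

definition nonneg_series :: "(nat \<Rightarrow> real) \<Rightarrow> bool" where
  "nonneg_series u \<longleftrightarrow> u 0 > 0 \<and> (\<forall>z. summable (\<lambda>n. u n * z ^ n)) \<and> (\<forall>z\<le>0. 0 \<le> (\<Sum>n. u n * z ^ n))"

definition pos_series :: "(nat \<Rightarrow> real) \<Rightarrow> bool" where
  "pos_series u \<longleftrightarrow> u 0 > 0 \<and> (\<forall>z. summable (\<lambda>n. u n * z ^ n)) \<and> (\<forall>z\<le>0. 0 < (\<Sum>n. u n * z ^ n))"

lemma pos_imp_nonneg_series: "pos_series u \<Longrightarrow> nonneg_series u"
  unfolding pos_series_def nonneg_series_def by (auto intro: less_imp_le)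

lemma entire_series_abs_summable:
  fixes u :: "nat \<Rightarrow> real"
  assumes "\<And>z. summable (\<lambda>n. u n * z ^ n)"
  shows "summable (\<lambda>n. \<bar>u n * z ^ n\<bar>)"
  using powser_insidea[OF assms[of "\<bar>z\<bar> + 1"], of z] by simp

section \<open>Raising a denominator parameter by a Beta integral\<close>

text \<open>The quotient on the right is the \<open>n\<close>-th moment of the normalized Beta
  weight; multiplying a coefficient by it replaces \<open>pochhammer b n\<close> by
  \<open>pochhammer (b + e) n\<close> in the denominator.\<close>

lemma Beta_add_nat:
  fixes b e :: real
  assumes "0 < b" "0 < e"
  shows "Beta (b + real n) e = Beta b e * (pochhammer b n / pochhammer (b + e) n)"
proof -
  have nz: "Gamma b \<noteq> 0" "Gamma (b + e) \<noteq> 0"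
    using Gamma_real_pos[of b] Gamma_real_pos[of "b + e"] assms by linarith+
  have "b \<notin> \<int>\<^sub>\<le>\<^sub>0" "b + e \<notin> \<int>\<^sub>\<le>\<^sub>0" using assms by (auto elim!: nonpos_Ints_cases)
  then show ?thesis
    using nz by (simp add: Beta_def pochhammer_Gamma add_ac)
qed

lemma beta_transform:
  fixes u :: "nat \<Rightarrow> real"
  assumes b: "0 < b" and e: "0 < e" and entire: "\<And>z. summable (\<lambda>n. u n / pochhammer b n * z ^ n)"
  shows "(\<lambda>n. u n / pochhammer (b + e) n * z ^ n) sums
    (integral {0..1} (\<lambda>t. (\<Sum>n. u n / pochhammer b n * (z * t) ^ n) * (t powr (b - 1) * (1 - t) powr (e - 1))) / Beta b e)"
   (is "_ sums (integral _ ?g / _)")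
   and "(\<lambda>t. (\<Sum>n. u n / pochhammer b n * (z * t) ^ n) * (t powr (b - 1) * (1 - t) powr (e - 1))) integrable_on {0..1}"
proof -
  define w where "w t = t powr (b - 1) * (1 - t) powr (e - 1)" for t :: real
  define v where "v n = u n / pochhammer b n" for n
  define f where "f N t = (\<Sum>n<N. v n * (z * t) ^ n) * w t" for N t
  define h where "h t = (\<Sum>n. \<bar>v n * z ^ n\<bar>) * w t" for t
  have w0: "0 \<le> w t" if "t \<in> {0..1}" for t using that by (simp add: w_def)
  have pos: "pochhammer b n > 0" for n by (simp add: b pochhammer_pos)
  have B: "Beta b e > 0" using b e by (simp add: Beta_def Gamma_real_pos)
  have sv: "summable (\<lambda>n. \<bar>v n * y ^ n\<bar>)" for y
    using entire_series_abs_summable[of v y] entire by (simp add: v_def)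
  have term_integral: "((\<lambda>t. v n * (z * t) ^ n * w t) has_integral
      Beta b e * (u n / pochhammer (b + e) n * z ^ n)) {0..1}" for n
  proof -
    have "((\<lambda>t. v n * z ^ n * (t powr (b + n - 1) * (1 - t) powr (e - 1))) has_integral
        v n * z ^ n * Beta (b + n) e) {0..1}"
      by (intro has_integral_mult_right has_integral_Beta_real) (use b e in auto)
    moreover have "v n * z ^ n * (t powr (b + n - 1) * (1 - t) powr (e - 1)) = v n * (z * t) ^ n * w t"
      if "t \<in> {0..1}" for t
    \<comment> \<open>Splitting off \<open>t ^ n\<close> needs \<open>t > 0\<close>; at
      \<open>t = 0\<close> both sides vanish because \<open>0 powr y = 0\<close>, whatever the
      exponent.\<close>
    proof (cases "t = 0")
      case False
      then have "t > 0" using that by simp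
      then have "t powr (b + n - 1) = t ^ n * t powr (b - 1)"
        using powr_add[of t "b - 1" "real n"] by (simp add: powr_realpow algebra_simps)
      then show ?thesis by (simp add: w_def power_mult_distrib)
    qed (simp add: w_def)
    ultimately have "((\<lambda>t. v n * (z * t) ^ n * w t) has_integral v n * z ^ n * Beta (b + n) e) {0..1}"
      using has_integral_cong by (smt (verit))
    then show ?thesis
      using pos[of n] by (simp add: Beta_add_nat[OF b e] v_def field_simps)
  qed
  have fint: "(f N has_integral Beta b e * (\<Sum>n<N. u n / pochhammer (b + e) n * z ^ n)) {0..1}" for N
    unfolding f_def sum_distrib_left sum_distrib_right by (intro has_integral_sum term_integral) simp
  have hint: "h integrable_on {0..1}"
    unfolding h_def w_def
    by (intro integrable_on_mult_right has_integral_integrable[OF has_integral_Beta_real]) (use b e in auto)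
  \<comment> \<open>As \<open>t\<close> lies in the unit interval, the absolute series at
    \<open>z\<close> dominates every partial sum at \<open>z * t\<close>. So \<open>h\<close>, a
    constant times the Beta weight, serves all \<open>N\<close> in dominated convergence.\<close>
  have bound: "norm (f N t) \<le> h t" if t: "t \<in> {0..1}" for N t
  proof -
    have "\<bar>\<Sum>n<N. v n * (z * t) ^ n\<bar> \<le> (\<Sum>n<N. \<bar>v n * (z * t) ^ n\<bar>)" by (rule sum_abs)
    also have "\<dots> \<le> (\<Sum>n<N. \<bar>v n * z ^ n\<bar>)"
    proof (rule sum_mono)
      fix n
      have "\<bar>t\<bar> ^ n \<le> 1" using t by (simp add: power_le_one)
      then have "\<bar>v n * z ^ n\<bar> * \<bar>t\<bar> ^ n \<le> \<bar>v n * z ^ n\<bar> * 1"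
        by (intro mult_left_mono) auto
      then show "\<bar>v n * (z * t) ^ n\<bar> \<le> \<bar>v n * z ^ n\<bar>"
        by (simp add: power_mult_distrib abs_mult power_abs mult_ac)
    qed
    also have "\<dots> \<le> (\<Sum>n. \<bar>v n * z ^ n\<bar>)" by (intro sum_le_suminf sv) auto
    finally show ?thesis
      using w0[OF t] by (simp add: f_def h_def abs_mult mult_right_mono)
  qed
  have lim: "(\<lambda>N. f N t) \<longlonglongrightarrow> ?g t" if "t \<in> {0..1}" for t
  proof -
    have "(\<lambda>n. v n * (z * t) ^ n) sums (\<Sum>n. v n * (z * t) ^ n)"
      by (rule summable_sums[OF summable_rabs_cancel[OF sv]])
    then show ?thesis
      unfolding f_def sums_def w_def v_def by (intro tendsto_mult_right)
  qed
  have f: "f N integrable_on {0..1}" for N using fint by blast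
  show "?g integrable_on {0..1}"
    by (rule dominated_convergence(1)[OF f hint bound lim])
  have "(\<lambda>N. integral {0..1} (f N)) \<longlonglongrightarrow> integral {0..1} ?g"
    by (rule dominated_convergence(2)[OF f hint bound lim])
  then have "(\<lambda>N. Beta b e * (\<Sum>n<N. u n / pochhammer (b + e) n * z ^ n)) \<longlonglongrightarrow> integral {0..1} ?g"
    unfolding integral_unique[OF fint] .
  then have "(\<lambda>N. Beta b e * (\<Sum>n<N. u n / pochhammer (b + e) n * z ^ n) / Beta b e) \<longlonglongrightarrow> integral {0..1} ?g / Beta b e"
    using B by (intro tendsto_divide) auto
  then show "(\<lambda>n. u n / pochhammer (b + e) n * z ^ n) sums (integral {0..1} ?g / Beta b e)"
    using B by (simp add: sums_def)
qed

text \<open>The Beta integrand is nonnegative, and near \<open>t = 0\<close> the factor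
  \<open>f (z * t)\<close> is close to \<open>f 0 = u 0 > 0\<close>. Hence the integral is strictly
  positive even if \<open>f\<close> has zeros on the negative half-line.\<close>

lemma pos_series_raise:
  assumes b: "0 < b" and e: "0 < e" and nn: "nonneg_series (\<lambda>n. u n / pochhammer b n)"
  shows "pos_series (\<lambda>n. u n / pochhammer (b + e) n)"
proof -
  define f where "f z = (\<Sum>n. u n / pochhammer b n * z ^ n)" for z
  have entire: "summable (\<lambda>n. u n / pochhammer b n * z ^ n)" for z
    using nn by (simp add: nonneg_series_def)
  have u0: "u 0 > 0" using nn by (simp add: nonneg_series_def)
  have f0: "0 \<le> f z" if "z \<le> 0" for z using nn that by (simp add: nonneg_series_def f_def)
  have B: "Beta b e > 0" using b e by (simp add: Beta_def Gamma_real_pos)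
  have cont: "isCont f z" for z
    unfolding f_def by (rule isCont_powser[OF entire[of "\<bar>z\<bar> + 1"]]) simp
  have contz: "isCont (\<lambda>t. f (z * t)) t" for z t
    by (rule isCont_o2[where g = f, OF _ cont]) simp
  have pos: "0 < integral {0..1} (\<lambda>t. f (z * t) * (t powr (b - 1) * (1 - t) powr (e - 1)))"
    if z: "z \<le> 0" for z
  proof -
    define g where "g t = f (z * t) * (t powr (b - 1) * (1 - t) powr (e - 1))" for t
    have gi: "g integrable_on {0..1}"
      using beta_transform(2)[OF b e entire] unfolding g_def f_def .
    have g0: "0 \<le> g t" if "t \<in> {0..1}" for t
      using that z by (auto simp: g_def intro!: mult_nonneg_nonneg f0 mult_nonpos_nonneg)
    have "f 0 = u 0" using powser_zero[of "\<lambda>n. u n / pochhammer b n"] by (simp add: f_def)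
    then have "f (z * 0) > 0" using u0 by simp
    with contz[where z = z and t = 0] have "eventually (\<lambda>t. 0 < f (z * t)) (at 0)"
      unfolding isCont_def by (rule order_tendstoD(1))
    then obtain r where r: "r > 0" "\<And>t. t \<noteq> 0 \<Longrightarrow> \<bar>t\<bar> < r \<Longrightarrow> 0 < f (z * t)"
      by (auto simp: eventually_at)
    \<comment> \<open>The interval from \<open>s / 2\<close> to \<open>s\<close> stays where
      \<open>f (z * t)\<close> is positive and away from 0 and 1, where the weight may be singular;
      so \<open>g\<close> is continuous on it and its integral cannot vanish.\<close>
    define s where "s = min (r / 2) (1 / 2)"
    have s: "0 < s" "s \<le> 1 / 2" "s < r" using r by (auto simp: s_def)
    have gs: "0 < g s" using r(2)[of s] s by (simp add: g_def)
    have sub: "{s / 2..s} \<subseteq> {0..1}" using s by auto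
    have "continuous_on {s / 2..s} (\<lambda>t. f (z * t))"
      by (intro continuous_at_imp_continuous_on ballI contz)
    then have gc: "continuous_on (cbox (s / 2) s) g"
      unfolding g_def cbox_interval using s by (intro continuous_intros) auto
    have gis: "g integrable_on {s / 2..s}" using gi sub integrable_on_subinterval by blast
    have "integral {s / 2..s} g \<noteq> 0"
    proof
      assume "integral {s / 2..s} g = 0"
      then have "(g has_integral 0) (cbox (s / 2) s)"
        using gis by (metis cbox_interval has_integral_integral)
      then have "g s = 0"
        using s sub g0 by (intro has_integral_0_cbox_imp_0[OF gc]) (auto simp: mem_box subset_iff)
      then show False using gs by simp
    qed
    moreover have "0 \<le> integral {s / 2..s} g"
      using sub g0 by (intro integral_nonneg gis) auto
    moreover have "integral {s / 2..s} g \<le> integral {0..1} g"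
      by (rule integral_subset_le[OF sub gis gi]) (use g0 in auto)
    ultimately show ?thesis unfolding g_def by linarith
  qed
  have sums: "(\<lambda>n. u n / pochhammer (b + e) n * z ^ n) sums
     (integral {0..1} (\<lambda>t. f (z * t) * (t powr (b - 1) * (1 - t) powr (e - 1))) / Beta b e)" for z
    unfolding f_def by (rule beta_transform(1)[OF b e entire])
  show ?thesis
    unfolding pos_series_def
  proof (intro conjI allI impI)
    fix z :: real assume "z \<le> 0"
    show "0 < (\<Sum>n. u n / pochhammer (b + e) n * z ^ n)"
      using divide_pos_pos[OF pos[OF \<open>z \<le> 0\<close>] B] unfolding sums_unique[OF sums[of z]] .
  qed (use u0 sums in \<open>auto simp: sums_iff\<close>)
qed

section \<open>Gauss's series at argument 1 under integer shifts of its lower parameter\<close>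

lemma gauss_series_ratio:
  fixes c d e :: real
  assumes "0 < c"
  defines "t \<equiv> \<lambda>k. pochhammer d k * pochhammer e k / (fact k * pochhammer c k)"
  shows "t (Suc k) * ((real k + 1) * (c + k)) = t k * ((d + k) * (e + k))"
proof -
  have "pochhammer c k > 0" "c + k > 0" using assms by (auto simp: pochhammer_pos)
  then show ?thesis by (simp add: t_def pochhammer_Suc divide_simps)
qed

text \<open>The ratio of consecutive terms tends to 1, so Raabe's test is used; its limit
  \<open>1 + c - d - e\<close> exceeds 1 exactly when \<open>d + e < c\<close>.\<close>

lemma gauss_series_summable:
  fixes c d e :: real
  assumes de: "0 < d" "0 < e" and c: "d + e < c"
  shows "summable (\<lambda>k. pochhammer d k * pochhammer e k / (fact k * pochhammer c k))" (is "summable ?t")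
proof -
  have pos: "?t k > 0" for k using de c by (auto simp: pochhammer_pos)
  have eq: "real k * (?t k / ?t (Suc k) - 1) = real k * ((real k + 1) * (c + k) / ((d + k) * (e + k)) - 1)" for k
  proof -
    have "(d + k) * (e + k) > 0" using de by simp
    then have "?t k / ?t (Suc k) = (real k + 1) * (c + k) / ((d + k) * (e + k))"
      using gauss_series_ratio[of c d k e] pos[of "Suc k"] de c
      by (subst frac_eq_eq) (auto simp: mult_ac)
    then show ?thesis by simp
  qed
  have "(\<lambda>k. real k * ((real k + 1) * (c + k) / ((d + k) * (e + k)) - 1)) \<longlonglongrightarrow> 1 + c - d - e"
    by (real_asymp simp: field_simps)
  then have "liminf (\<lambda>k. ereal (real k * (?t k / ?t (Suc k) - 1))) = ereal (1 + c - d - e)"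
    unfolding eq by (intro lim_imp_Liminf) auto
  then show ?thesis
    using c pos by (intro raabes_test_convergence[of ?t]) auto
qed

text \<open>
  Only integer shifts of \<open>c\<close> are needed, so this telescoping relation replaces Gauss' theorem
  in terms of Gamma functions.
\<close>
lemma gauss_series_contiguous:
  fixes d e :: real
  assumes de: "0 < d" "0 < e" and c: "d + e < c"
  defines "F \<equiv> \<lambda>c. \<Sum>k. pochhammer d k * pochhammer e k / (fact k * pochhammer c k)"
  shows "c * (c - d - e) * F c = (c - d) * (c - e) * F (c + 1)"
proof -
  define t where "t c k = pochhammer d k * pochhammer e k / (fact k * pochhammer c k)" for c k
  \<comment> \<open>Telescoping certificate: the wanted combination of the terms for
    \<open>c + 1\<close> and \<open>c\<close> is \<open>c\<close> times the forward difference of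
    \<open>G\<close>, so only the limit of \<open>G\<close> at infinity matters.\<close>
  define G where "G k = real k * t c k" for k
  have G0: "G 0 = 0" by (simp add: G_def)
  have c0: "c > 0" using de c by simp
  have pos: "t c k > 0" for k using de c by (auto simp: t_def pochhammer_pos)
  have s: "summable (t c)" and s1: "summable (t (c + 1))"
    using gauss_series_summable[OF de c] gauss_series_summable[OF de, of "c + 1"] c
    by (auto simp: t_def[abs_def])
  have t1: "t (c + 1) k * (c + k) = c * t c k" for k
  proof -
    have "pochhammer (c + 1) k * c = pochhammer c k * (c + k)"
      using pochhammer_rec[of c k] pochhammer_Suc[of c k] by (simp add: mult_ac)
    moreover have "pochhammer (c + 1) k > 0" "pochhammer c k > 0" using c0 by (auto simp: pochhammer_pos)
    ultimately show ?thesis by (simp add: t_def divide_simps mult_ac)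
  qed
  have tele: "(c - d) * (c - e) * t (c + 1) k - c * (c - d - e) * t c k = c * (G (Suc k) - G k)" for k
  proof -
    have ck: "c + k > 0" using c0 by simp
    have R: "G (Suc k) * (c + k) = t c k * ((d + k) * (e + k))"
      using gauss_series_ratio[OF c0, of d k e] by (simp add: G_def t_def mult_ac add_ac)
    have "((c - d) * (c - e) * t (c + 1) k - c * (c - d - e) * t c k) * (c + k)
        = (c * (G (Suc k) - G k)) * (c + k)"
      using R t1[of k] unfolding G_def by algebra
    then show ?thesis using ck by simp
  qed
  have sG: "summable (\<lambda>k. G (Suc k) - G k)"
  proof -
    have "summable (\<lambda>k. ((c - d) * (c - e) * t (c + 1) k - c * (c - d - e) * t c k) / c)"
      by (intro summable_divide summable_diff summable_mult s s1)
    then show ?thesis using c0 by (simp add: tele)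
  qed
  then have "(\<lambda>n. \<Sum>k<n. G (Suc k) - G k) \<longlonglongrightarrow> (\<Sum>k. G (Suc k) - G k)"
    by (rule summable_LIMSEQ)
  then obtain L where L: "G \<longlonglongrightarrow> L"
    by (auto simp: sum_lessThan_telescope G0)
  \<comment> \<open>A positive limit of \<open>k * t c k\<close> would bound \<open>t c k\<close>
    below by a multiple of \<open>1 / k\<close>, and the harmonic series would converge.\<close>
  have "L = 0"
  proof (rule ccontr)
    assume "L \<noteq> 0"
    moreover have "L \<ge> 0" using L pos by (intro LIMSEQ_le_const[OF L]) (auto simp: G_def less_imp_le)
    ultimately have "L > 0" "L / 2 < L" by auto
    have ev: "eventually (\<lambda>k. L / 2 < G k) sequentially" by (rule order_tendstoD(1)[OF L \<open>L / 2 < L\<close>])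
    have "summable (\<lambda>k. L / 2 * inverse (real k))"
    proof (rule summable_comparison_test_ev[OF _ s])
      show "eventually (\<lambda>k. norm (L / 2 * inverse (real k)) \<le> t c k) sequentially"
        using ev eventually_gt_at_top[of 0]
      proof eventually_elim
        case (elim k)
        then show ?case using \<open>L > 0\<close> by (simp add: G_def field_simps)
      qed
    qed
    then have "summable (\<lambda>k. inverse (real k))" using \<open>L > 0\<close> by (subst (asm) summable_cmult_iff) auto
    then show False using not_summable_harmonic[where 'a=real] by simp
  qed
  then have "(\<lambda>k. c * (G (Suc k) - G k)) sums (c * (0 - G 0))"
    using L by (intro sums_mult telescope_sums) auto
  moreover have "(\<lambda>k. (c - d) * (c - e) * t (c + 1) k - c * (c - d - e) * t c k) sums
      ((c - d) * (c - e) * F (c + 1) - c * (c - d - e) * F c)"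
    unfolding F_def by (intro sums_diff sums_mult) (use s s1 in \<open>auto simp: t_def[abs_def] summable_sums\<close>)
  ultimately have "(c - d) * (c - e) * F (c + 1) - c * (c - d - e) * F c = 0"
    unfolding tele using sums_unique2 by (fastforce simp: G_def)
  then show ?thesis by simp
qed

lemma pochhammer_le_pochhammer:
  fixes a b :: real
  assumes "0 \<le> a" "a \<le> b"
  shows "pochhammer a n \<le> pochhammer b n"
  unfolding pochhammer_prod by (rule prod_mono) (use assms in auto)

text \<open>Induction on the contiguous relation at \<open>c = p + d + e + n\<close>, where
  \<open>c - d - e\<close>, \<open>c - d\<close> and \<open>c - e\<close> are \<open>p + n\<close>,
  \<open>p + e + n\<close> and \<open>p + d + n\<close>: precisely the new factors of the Pochhammer
  symbols.\<close>

lemma gauss_series_shift: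
  fixes p d e :: real
  assumes p: "0 < p" and de: "0 < d" "0 < e"
  defines "F \<equiv> \<lambda>c. \<Sum>k. pochhammer d k * pochhammer e k / (fact k * pochhammer c k)"
  shows "F (p + d + e + n) * (pochhammer (p + d) n * pochhammer (p + e) n)
       = F (p + d + e) * (pochhammer p n * pochhammer (p + d + e) n)"
proof (induction n)
  case (Suc n)
  have "(p + d + e + n) * (p + n) * F (p + d + e + n) = (p + e + n) * (p + d + n) * F (p + d + e + n + 1)"
    using gauss_series_contiguous[OF de, of "p + d + e + n"] p
    by (simp add: F_def algebra_simps)
  then show ?case
    using Suc.IH by (simp add: pochhammer_Suc add_ac) algebra
qed simp

section \<open>Moving two denominator parameters closer together with their sum fixed\<close>

text \<open>The mixture has positive weights \<open>t q k\<close>. Its member \<open>k = 0\<close>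
  is nonnegative by hypothesis and those with \<open>k > 0\<close> are positive by raising
  \<open>q\<close>. Tannery's theorem allows summing over \<open>k\<close> outside the power
  series.\<close>

lemma pos_series_transfer:
  fixes p d e :: real
  assumes p: "0 < p" and de: "0 < d" "0 < e"
    and nn: "nonneg_series (\<lambda>n. u n / (pochhammer p n * pochhammer (p + d + e) n))"
  shows "pos_series (\<lambda>n. u n / (pochhammer (p + d) n * pochhammer (p + e) n))"
proof -
  define q where "q = p + d + e"
  have q: "0 < q" using p de by (simp add: q_def)
  define v where "v n = u n / pochhammer p n" for n
  define t where "t c k = pochhammer d k * pochhammer e k / (fact k * pochhammer c k)" for c k
  define F where "F c = (\<Sum>k. t c k)" for c
  have tpos: "t c k > 0" if "c > 0" for c k using that de by (simp add: t_def pochhammer_pos)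
  have tsum: "summable (t (q + real n))" for n
    using gauss_series_summable[OF de, of "q + n"] p by (simp add: t_def[abs_def] q_def)
  have tsum0: "summable (t q)" using tsum[of 0] by simp
  have Fq: "F q > 0" unfolding F_def by (intro suminf_pos tsum0 tpos q)
  have nn0: "nonneg_series (\<lambda>n. v n / pochhammer q n)"
    using nn by (simp add: v_def q_def)
  have pos: "pos_series (\<lambda>n. v n / pochhammer (q + real k) n)" if "k > 0" for k
    using pos_series_raise[OF q _ nn0, of "real k"] that by simp
  have nnk: "nonneg_series (\<lambda>n. v n / pochhammer (q + real k) n)" for k
    using pos[of k] pos_imp_nonneg_series nn0 by (cases "k = 0") auto
  \<comment> \<open>Both (q)_k (q+k)_n and (q)_n (q+n)_k equal (q)_(n+k). This turns the sum over
    \<open>k\<close> at fixed \<open>n\<close> into the Gauss series with lower parameter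
    \<open>q + n\<close>.\<close>
  have swap: "t q k / pochhammer (q + real k) n = t (q + real n) k / pochhammer q n" for k n
  proof -
    have "pochhammer q k * pochhammer (q + real k) n = pochhammer q n * pochhammer (q + real n) k"
      using pochhammer_product'[of q k n] pochhammer_product'[of q n k] by (simp add: add.commute)
    then show ?thesis by (simp add: t_def mult.assoc)
  qed
  have shift: "F (q + real n) * (v n / pochhammer q n)
      = F q * (u n / (pochhammer (p + d) n * pochhammer (p + e) n))" for n
  proof -
    have "pochhammer p n > 0" "pochhammer q n > 0" "pochhammer (p + d) n > 0" "pochhammer (p + e) n > 0"
      using p q de by (auto intro!: pochhammer_pos)
    then show ?thesis
      using gauss_series_shift[OF p de, of n]
      by (simp add: v_def F_def t_def q_def[symmetric] divide_simps)
  qed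
  have main: "summable (\<lambda>n. u n / (pochhammer (p + d) n * pochhammer (p + e) n) * z ^ n) \<and>
      (\<lambda>K. \<Sum>k<K. t q k * (\<Sum>n. v n / pochhammer (q + real k) n * z ^ n))
        \<longlonglongrightarrow> F q * (\<Sum>n. u n / (pochhammer (p + d) n * pochhammer (p + e) n) * z ^ n)" for z
  proof -
    \<comment> \<open>\<open>a n K\<close> is the \<open>n\<close>-th term of the mixture cut off at
      \<open>k < K\<close>, and \<open>b n\<close> its limit as \<open>K\<close> grows.\<close>
    define a where "a n K = (\<Sum>k<K. t q k * (v n / pochhammer (q + real k) n * z ^ n))" for n K
    define b where "b n = F q * (u n / (pochhammer (p + d) n * pochhammer (p + e) n) * z ^ n)" for n
    have sv: "summable (\<lambda>n. v n / pochhammer (q + real k) n * z ^ n)" for k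
      using nnk[of k] by (simp add: nonneg_series_def)
    have lim: "a n \<longlonglongrightarrow> b n" for n
    proof -
      have "t (q + real n) sums F (q + real n)" unfolding F_def by (rule summable_sums[OF tsum])
      then have "(\<lambda>k. t (q + real n) k * (v n / pochhammer q n * z ^ n)) sums
          (F (q + real n) * (v n / pochhammer q n * z ^ n))"
        by (rule sums_mult2)
      moreover have "t (q + real n) k * (v n / pochhammer q n * z ^ n)
          = t q k * (v n / pochhammer (q + real k) n * z ^ n)" for k
      proof -
        have "t (q + real n) k / pochhammer q n * (v n * z ^ n) = t q k / pochhammer (q + real k) n * (v n * z ^ n)"
          by (simp only: swap)
        then show ?thesis by simp
      qed
      moreover have "F (q + real n) * (v n / pochhammer q n * z ^ n) = b n"
        using shift[of n] unfolding b_def by (metis mult.assoc)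
      ultimately show ?thesis by (simp add: sums_def a_def[abs_def])
    qed
    \<comment> \<open>Since \<open>pochhammer (q + k) n\<close> is at least
      \<open>pochhammer q n\<close>, the majorant is independent of \<open>K\<close> and summable in
      \<open>n\<close>.\<close>
    have bound: "norm (a n K) \<le> F q * \<bar>v n / pochhammer q n * z ^ n\<bar>" for n K
    proof -
      have "norm (a n K) \<le> (\<Sum>k<K. norm (t q k * (v n / pochhammer (q + real k) n * z ^ n)))"
        unfolding a_def by (rule norm_sum)
      also have "\<dots> \<le> (\<Sum>k<K. t q k * \<bar>v n / pochhammer q n * z ^ n\<bar>)"
      proof (rule sum_mono)
        fix k
        have "pochhammer q n \<le> pochhammer (q + real k) n" "pochhammer q n > 0"
          using q by (auto intro!: pochhammer_le_pochhammer pochhammer_pos)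
        then have "\<bar>v n / pochhammer (q + real k) n * z ^ n\<bar> \<le> \<bar>v n / pochhammer q n * z ^ n\<bar>"
          by (auto simp: abs_mult intro!: mult_right_mono divide_left_mono)
        then show "norm (t q k * (v n / pochhammer (q + real k) n * z ^ n)) \<le> t q k * \<bar>v n / pochhammer q n * z ^ n\<bar>"
          using mult_left_mono[OF _ less_imp_le[OF tpos[OF q, of k]]] abs_of_pos[OF tpos[OF q, of k]]
          by (simp only: real_norm_def abs_mult[of "t q k"])
      qed
      also have "\<dots> = (\<Sum>k<K. t q k) * \<bar>v n / pochhammer q n * z ^ n\<bar>"
        by (simp only: sum_distrib_right)
      also have "\<dots> \<le> F q * \<bar>v n / pochhammer q n * z ^ n\<bar>"
        unfolding F_def
        by (intro mult_right_mono sum_le_suminf tsum0) (use tpos[OF q] in \<open>auto intro: less_imp_le\<close>)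
      finally show ?thesis .
    qed
    have "summable (\<lambda>n. \<bar>v n / pochhammer q n * z ^ n\<bar>)"
      using nn0 by (intro entire_series_abs_summable) (simp add: nonneg_series_def)
    then have dom: "summable (\<lambda>n. F q * \<bar>v n / pochhammer q n * z ^ n\<bar>)" by (rule summable_mult)
    have ev: "\<forall>\<^sub>F (n, K) in sequentially \<times>\<^sub>F sequentially. norm (a n K) \<le> F q * \<bar>v n / pochhammer q n * z ^ n\<bar>"
      using bound by (intro always_eventually) blast
    note tannery = tannerys_theorem[where a = a and b = b, OF lim ev dom trivial_limit_sequentially]
    have "summable b" by (rule summable_norm_cancel[OF conjunct1[OF conjunct2[OF tannery]]])
    then have sb: "summable (\<lambda>n. u n / (pochhammer (p + d) n * pochhammer (p + e) n) * z ^ n)"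
      unfolding b_def using Fq by (subst (asm) summable_cmult_iff) auto
    have "suminf b = F q * (\<Sum>n. u n / (pochhammer (p + d) n * pochhammer (p + e) n) * z ^ n)"
      unfolding b_def by (rule suminf_mult[OF sb])
    moreover have "(\<Sum>n. a n K) = (\<Sum>k<K. t q k * (\<Sum>n. v n / pochhammer (q + real k) n * z ^ n))" for K
    proof -
      have "(\<Sum>n. a n K) = (\<Sum>k<K. \<Sum>n. t q k * (v n / pochhammer (q + real k) n * z ^ n))"
        unfolding a_def by (rule suminf_sum) (rule summable_mult[OF sv])
      then show ?thesis by (simp only: suminf_mult[OF sv])
    qed
    ultimately show ?thesis using tannery sb by simp
  qed
  show ?thesis
    unfolding pos_series_def
  proof (intro conjI allI impI)
    show "0 < u 0 / (pochhammer (p + d) 0 * pochhammer (p + e) 0)"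
      using nn by (simp add: nonneg_series_def)
    show "summable (\<lambda>n. u n / (pochhammer (p + d) n * pochhammer (p + e) n) * z ^ n)" for z
      using main by blast
    fix z :: real assume z: "z \<le> 0"
    define S where "S k = (\<Sum>n. v n / pochhammer (q + real k) n * z ^ n)" for k
    have S0: "S k \<ge> 0" for k using nnk[of k] z unfolding S_def nonneg_series_def by blast
    \<comment> \<open>Strictness comes from the single member \<open>k = 1\<close>; the others are
      only used as nonnegative.\<close>
    have S1: "S 1 > 0" using pos[OF zero_less_one] z unfolding S_def pos_series_def by blast
    have "t q 1 * S 1 \<le> (\<Sum>k<K. t q k * S k)" if "K \<ge> 2" for K
      using that tpos[OF q] S0
      by (intro member_le_sum) (auto intro: mult_nonneg_nonneg less_imp_le)
    then have "t q 1 * S 1 \<le> F q * (\<Sum>n. u n / (pochhammer (p + d) n * pochhammer (p + e) n) * z ^ n)"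
      using LIMSEQ_le_const[OF conjunct2[OF main[of z]]] unfolding S_def by blast
    then have "0 < F q * (\<Sum>n. u n / (pochhammer (p + d) n * pochhammer (p + e) n) * z ^ n)"
      by (rule less_le_trans[OF mult_pos_pos[OF tpos[OF q] S1]])
    then show "0 < (\<Sum>n. u n / (pochhammer (p + d) n * pochhammer (p + e) n) * z ^ n)"
      using Fq by (simp add: zero_less_mult_iff)
  qed
qed

section \<open>Weak majorization for two and three parameters\<close>

text \<open>With the target ordered as \<open>x <= y\<close>: if \<open>q <= y\<close>, both
  parameters are raised; otherwise a transfer lowers \<open>q\<close> to \<open>y\<close>, and the
  other parameter is then raised to \<open>x\<close>. Every actual move is strict, so the only
  exception is that nothing moves.\<close>

lemma pos_series_two_parameters:
  fixes p q p' q' :: real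
  assumes p: "0 < p" and q: "0 < q" and le: "p \<le> p'" "p \<le> q'" and sum: "p + q \<le> p' + q'"
    and nn: "nonneg_series (\<lambda>n. u n / (pochhammer p n * pochhammer q n))"
  shows "pos_series (\<lambda>n. u n / (pochhammer p' n * pochhammer q' n)) \<or> {#p', q'#} = {#p, q#}"
proof -
  define N where "N x y \<longleftrightarrow> nonneg_series (\<lambda>n. u n / (pochhammer x n * pochhammer y n))" for x y
  define P where "P x y \<longleftrightarrow> pos_series (\<lambda>n. u n / (pochhammer x n * pochhammer y n))" for x y
  have N: "N p q" using nn by (simp add: N_def)
  have PN: "N x y" if "P x y" for x y using that unfolding P_def N_def by (rule pos_imp_nonneg_series)
  have sym: "P x y \<longleftrightarrow> P y x" "N x y \<longleftrightarrow> N y x" for x y unfolding P_def N_def by (simp_all add: mult.commute)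
  have raise: "P x y'" if "N x y" "0 < y" "y < y'" for x y y'
    using pos_series_raise[of y "y' - y" "\<lambda>n. u n / pochhammer x n"] that by (simp add: N_def P_def)
  have raise2: "P x' y' \<or> (x' = x \<and> y' = y)" if "N x y" "0 < x" "0 < y" "x \<le> x'" "y \<le> y'" for x y x' y'
    using raise[of x y y'] raise[of y' x x'] raise[of y x x'] PN sym that
    by (metis order_le_less)
  have ordered: "P x y \<or> {#x, y#} = {#p, q#}" if "p \<le> x" "x \<le> y" "p + q \<le> x + y" for x y
  proof (cases "q \<le> y")
    case True
    then show ?thesis using raise2[OF N p q \<open>p \<le> x\<close>] by blast
  next
    case False
    \<comment> \<open>The transfer lands on \<open>p + d = p + q - y\<close> and
      \<open>p + e = y\<close>. That \<open>e > 0\<close> follows from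
      \<open>p + q <= x + y <= 2 * y\<close> and \<open>y < q\<close>.\<close>
    define d where "d = q - y"
    define e where "e = y - p"
    have "0 < d" "0 < e" using False that by (auto simp: d_def e_def)
    moreover have "nonneg_series (\<lambda>n. u n / (pochhammer p n * pochhammer (p + d + e) n))"
      using N by (simp add: N_def d_def e_def)
    ultimately have "P (p + d) (p + e)"
      unfolding P_def using pos_series_transfer[OF p] by blast
    then have "P (p + q - y) y" by (simp add: d_def e_def algebra_simps)
    then show ?thesis
      using raise2[of "p + q - y" y x y] PN that p False by fastforce
  qed
  show ?thesis
    using ordered[of p' q'] ordered[of q' p'] linear[of p' q'] le sum sym(1)[of p' q']
    unfolding P_def by (auto simp: add_mset_commute)
qed

text \<open>Two applications of the two-parameter case: the first produces \<open>b1\<close> from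
  \<open>A\<close> and one of \<open>m\<close>, \<open>M\<close>, the second turns the remaining
  pair into \<open>b2\<close>, \<open>b3\<close>.\<close>

lemma pos_series_majorized_sorted:
  fixes A m M b1 b2 b3 :: real and u :: "nat \<Rightarrow> real"
  defines "N \<equiv> \<lambda>x y z. nonneg_series (\<lambda>n. u n / (pochhammer x n * pochhammer y n * pochhammer z n))"
  defines "P \<equiv> \<lambda>x y z. pos_series (\<lambda>n. u n / (pochhammer x n * pochhammer y n * pochhammer z n))"
  assumes A: "0 < A" "A \<le> m" "m \<le> M" and N: "N A m M"
    and b: "b1 \<le> b2" "b2 \<le> b3" and maj: "A \<le> b1" "A + m \<le> b1 + b2" "A + m + M \<le> b1 + b2 + b3"
  shows "P b1 b2 b3 \<or> {#b1, b2, b3#} = {#A, m, M#}"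
proof -
  have PN: "N x y z" if "P x y z" for x y z
    using that unfolding P_def N_def by (rule pos_imp_nonneg_series)
  have symP: "P x y z \<longleftrightarrow> P y x z" "P x y z \<longleftrightarrow> P x z y" for x y z
    unfolding P_def by (simp_all add: mult_ac)
  have symN: "N x y z \<longleftrightarrow> N y x z" "N x y z \<longleftrightarrow> N x z y" for x y z
    unfolding N_def by (simp_all add: mult_ac)
  have step: "P p' q' r \<or> {#p', q'#} = {#p, q#}"
    if "N p q r" "0 < p" "0 < q" "p \<le> p'" "p \<le> q'" "p + q \<le> p' + q'" for p q r p' q'
    using pos_series_two_parameters[of p q p' q' "\<lambda>n. u n / pochhammer r n"] that
    by (simp add: N_def P_def mult_ac)
  have symP': "P x y z" if "P x' y' z'" "{#x, y, z#} = {#x', y', z'#}" for x y z x' y' z'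
    using that symP by (auto simp: add_eq_conv_ex)
  \<comment> \<open>Here \<open>x\<close> is the partner created with \<open>b1\<close> and
    \<open>r\<close> the parameter left alone. Strictness gained in the first move survives a
    trivial second one; if both are trivial, the multisets agree.\<close>
  have chain: "P b1 b2 b3 \<or> {#b1, b2, b3#} = {#A, m, M#}"
    if 1: "P b1 x r \<or> {#b1, x#} = {#p, q#}" and pqr: "{#p, q, r#} = {#A, m, M#}"
      and 2: "N b1 x r \<Longrightarrow> P b2 b3 b1 \<or> {#b2, b3#} = {#x, r#}" for x p q r
  proof -
    have mem: "{#b1, x, r#} = {#A, m, M#} \<or> P b1 x r"
    proof (cases "P b1 x r")
      case False
      have "{#b1, x, r#} = add_mset r {#b1, x#}" by (simp add: add_mset_commute)
      also have "\<dots> = add_mset r {#p, q#}" using 1 False by simp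
      also have "\<dots> = {#p, q, r#}" by (simp add: add_mset_commute)
      finally show ?thesis using pqr by simp
    qed simp
    have "N b1 x r" if "{#b1, x, r#} = {#A, m, M#}"
      using that N symN by (auto simp: add_eq_conv_ex)
    then have "P b2 b3 b1 \<or> {#b2, b3#} = {#x, r#}" using 2 PN mem by blast
    then show ?thesis
    proof
      assume "P b2 b3 b1"
      then show ?thesis using symP by blast
    next
      assume "{#b2, b3#} = {#x, r#}"
      then have "{#b1, b2, b3#} = {#b1, x, r#}" by simp
      then show ?thesis using symP' mem by metis
    qed
  qed
  show ?thesis
  proof (cases "b1 \<le> m")
    \<comment> \<open>Pairing \<open>A\<close> with \<open>m\<close> keeps the partner
      \<open>A + m - b1\<close> at least \<open>A\<close>, and the bound on \<open>b1 + b2\<close>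
      keeps it at most \<open>b2\<close>.\<close>
    case True
    show ?thesis
    proof (rule chain)
      show "P b1 (A + m - b1) M \<or> {#b1, A + m - b1#} = {#A, m#}"
        by (rule step) (use A N True maj in auto)
      show "P b2 b3 b1 \<or> {#b2, b3#} = {#A + m - b1, M#}" if "N b1 (A + m - b1) M"
        by (rule step) (use that symN A True maj b in auto)
    qed simp
  next
    \<comment> \<open>Now \<open>m < b1\<close>, so \<open>m\<close> is left alone and is the lower
      bound for the second move. The \<open>max\<close> stops the partner of \<open>b1\<close> from
      falling below \<open>A\<close> when \<open>b1 > M\<close>.\<close>
    case False
    show ?thesis
    proof (rule chain)
      show "P b1 (max A (A + M - b1)) m \<or> {#b1, max A (A + M - b1)#} = {#A, M#}"
        by (rule step) (use A N symN False maj in auto)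
      show "{#A, M, m#} = {#A, m, M#}" by simp
      have "P b2 b3 b1 \<or> {#b2, b3#} = {#m, max A (A + M - b1)#}" if "N b1 (max A (A + M - b1)) m"
        by (rule step) (use that symN A False maj b in auto)
      then show "P b2 b3 b1 \<or> {#b2, b3#} = {#max A (A + M - b1), m#}" if "N b1 (max A (A + M - b1)) m"
        using that by (simp add: add_mset_commute)
    qed
  qed
qed

lemma pos_series_majorized:
  fixes A m M b1 b2 b3 :: real
  assumes A: "0 < A" "A \<le> m" "m \<le> M"
    and nn: "nonneg_series (\<lambda>n. u n / (pochhammer A n * pochhammer m n * pochhammer M n))"
    and maj: "A \<le> b1" "A \<le> b2" "A \<le> b3" "A + m \<le> b1 + b2" "A + m \<le> b1 + b3" "A + m \<le> b2 + b3"
      "A + m + M \<le> b1 + b2 + b3"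
  shows "pos_series (\<lambda>n. u n / (pochhammer b1 n * pochhammer b2 n * pochhammer b3 n))
    \<or> {#b1, b2, b3#} = {#A, m, M#}"
proof -
  note sorted = pos_series_majorized_sorted[OF A nn]
  consider "b1 \<le> b2" "b2 \<le> b3" | "b1 \<le> b3" "b3 \<le> b2" | "b2 \<le> b1" "b1 \<le> b3"
    | "b2 \<le> b3" "b3 \<le> b1" | "b3 \<le> b1" "b1 \<le> b2" | "b3 \<le> b2" "b2 \<le> b1"
    by linarith
  then show ?thesis
  proof cases
    case 1 then show ?thesis using sorted[of b1 b2 b3] maj by (simp add: mult_ac add_mset_commute)
  next
    case 2 then show ?thesis using sorted[of b1 b3 b2] maj by (simp add: mult_ac add_mset_commute)
  next
    case 3 then show ?thesis using sorted[of b2 b1 b3] maj by (simp add: mult_ac add_mset_commute)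
  next
    case 4 then show ?thesis using sorted[of b2 b3 b1] maj by (simp add: mult_ac add_mset_commute)
  next
    case 5 then show ?thesis using sorted[of b3 b1 b2] maj by (simp add: mult_ac add_mset_commute)
  next
    case 6 then show ?thesis using sorted[of b3 b2 b1] maj by (simp add: mult_ac add_mset_commute)
  qed
qed

section \<open>The vertex case as a square\<close>

text \<open>The Cauchy product coefficients of the squared 0F1 series are Chu-Vandermonde sums, and
  the duplication formula puts them in the stated form. Convergence and nonnegativity at every real
  \<open>z\<close> come together.\<close>

lemma sums_square_0F1:
  fixes a z :: real
  assumes a: "0 < a"
  shows "(\<lambda>n. pochhammer a n / (fact n * pochhammer (a + 1/2) n * pochhammer (2 * a) n) * z ^ n) sums
    (\<Sum>n. (z / 4) ^ n / (fact n * pochhammer (a + 1/2) n))\<^sup>2"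
proof -
  define c where "c = a + 1/2"
  have c: "0 < c" using a by (simp add: c_def)
  define w where "w n = (z / 4) ^ n / (fact n * pochhammer c n)" for n
  have pc: "pochhammer c n > 0" for n using c by (rule pochhammer_pos)
  have "summable (\<lambda>n. norm (w n))"
  proof (rule summable_comparison_test')
    show "summable (\<lambda>n. inverse (fact n) * \<bar>z / 2\<bar> ^ n)" by (rule summable_exp)
    fix n :: nat
    \<comment> \<open>Each factor of \<open>pochhammer c n\<close> is at least 1/2, which gives
      comparison with the exponential series at \<open>\<bar>z / 2\<bar>\<close>.\<close>
    have "(\<Prod>i<n. 1/2) \<le> (\<Prod>i<n. c + of_nat i)"
      by (rule prod_mono) (use a in \<open>auto simp: c_def\<close>)
    then have "(1/2) ^ n \<le> pochhammer c n" by (simp add: pochhammer_prod atLeast0LessThan)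
    then have "\<bar>z / 2\<bar> ^ n * (1/2) ^ n \<le> \<bar>z / 2\<bar> ^ n * pochhammer c n"
      by (intro mult_left_mono) auto
    moreover have "\<bar>z / 4\<bar> ^ n = \<bar>z / 2\<bar> ^ n * (1/2) ^ n"
      by (simp add: power_mult_distrib[symmetric])
    ultimately have "\<bar>z / 4\<bar> ^ n / pochhammer c n \<le> \<bar>z / 2\<bar> ^ n"
      using pc[of n] by (simp add: pos_divide_le_eq)
    then have "\<bar>z / 4\<bar> ^ n / pochhammer c n * inverse (fact n) \<le> \<bar>z / 2\<bar> ^ n * inverse (fact n)"
      by (rule mult_right_mono) simp
    moreover have "norm (w n) = \<bar>z / 4\<bar> ^ n / pochhammer c n * inverse (fact n)"
      using pc[of n] by (simp add: w_def abs_mult power_abs divide_simps)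
    ultimately show "norm (norm (w n)) \<le> inverse (fact n) * \<bar>z / 2\<bar> ^ n"
      by (simp add: mult.commute)
  qed
  then have "(\<lambda>n. \<Sum>i\<le>n. w i * w (n - i)) sums ((\<Sum>n. w n) * (\<Sum>n. w n))"
    by (intro Cauchy_product_sums)
  moreover have "(\<Sum>i\<le>n. w i * w (n - i)) = pochhammer a n / (fact n * pochhammer c n * pochhammer (2 * a) n) * z ^ n" for n
  proof -
    \<comment> \<open>With this top argument, \<open>X gchoose i\<close> contributes
      \<open>pochhammer c (n - i)\<close> and \<open>X gchoose (n - i)\<close> contributes
      \<open>pochhammer c i\<close>, so the product \<open>w i * w (n - i)\<close> is a Vandermonde
      term up to a factor free of \<open>i\<close>.\<close>
    define X where "X = c + real n - 1"
    have g: "X gchoose j = pochhammer c n / (pochhammer c (n - j) * fact j)" if "j \<le> n" for j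
    proof -
      have "pochhammer c n = pochhammer c (n - j) * pochhammer (c + real (n - j)) j"
        using pochhammer_product[of "n - j" n c] that by simp
      moreover have "X - real j + 1 = c + real (n - j)" using that by (simp add: X_def of_nat_diff)
      ultimately show ?thesis using pc[of "n - j"] by (simp add: gbinomial_pochhammer')
    qed
    have "w i * w (n - i) = (z / 4) ^ n / (pochhammer c n)\<^sup>2 * ((X gchoose i) * (X gchoose (n - i)))"
      if "i \<le> n" for i
    proof -
      have "(z / 4) ^ n = (z / 4) ^ i * (z / 4) ^ (n - i)" using that by (simp flip: power_add)
      then show ?thesis
        using that pc[of n] g[of i] g[of "n - i"] by (simp add: w_def power2_eq_square)
    qed
    then have "(\<Sum>i\<le>n. w i * w (n - i))
        = (\<Sum>i\<le>n. (z / 4) ^ n / (pochhammer c n)\<^sup>2 * ((X gchoose i) * (X gchoose (n - i))))"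
      by (intro sum.cong) auto
    also have "\<dots> = (z / 4) ^ n / (pochhammer c n)\<^sup>2 * ((X + X) gchoose n)"
      by (simp only: sum_distrib_left atMost_atLeast0 flip: gbinomial_Vandermonde)
    also have "(X + X) gchoose n = pochhammer (2 * a + real n) n / fact n"
      by (simp add: gbinomial_pochhammer' X_def c_def algebra_simps)
    also have "(z / 4) ^ n / (pochhammer c n)\<^sup>2 * (pochhammer (2 * a + real n) n / fact n)
        = pochhammer a n / (fact n * pochhammer c n * pochhammer (2 * a) n) * z ^ n"
    proof -
      \<comment> \<open>Duplication of (2a)_(2n); its \<open>4 ^ n\<close> cancels the scaling
        \<open>z / 4\<close>.\<close>
      have "pochhammer (2 * a) n * pochhammer (2 * a + real n) n = 4 ^ n * pochhammer a n * pochhammer c n"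
      proof -
        have "pochhammer (2 * a) n * pochhammer (2 * a + real n) n = pochhammer (2 * a) (2 * n)"
          by (simp only: pochhammer_product' mult_2[of n])
        also have "\<dots> = 4 ^ n * pochhammer a n * pochhammer c n"
          by (simp add: pochhammer_double power_mult c_def)
        finally show ?thesis .
      qed
      moreover have "pochhammer (2 * a) n > 0" using a by (simp add: pochhammer_pos)
      ultimately show ?thesis
        using pc[of n] by (simp add: power_divide power2_eq_square divide_simps mult_ac)
    qed
    finally show ?thesis .
  qed
  ultimately show ?thesis by (simp add: w_def c_def power2_eq_square)
qed

section \<open>Linear inequalities on the Newton polyhedron\<close>

text \<open>The half-space where \<open>f\<close> is at least \<open>c\<close> is convex and
  contains every translated orthant, hence their hull.\<close>

lemma newton_polyhedron_lower_bound:
  assumes v: "v \<in> newton_polyhedron E" and f: "linear f"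
    and E: "\<And>x. x \<in> E \<Longrightarrow> c \<le> f x" and nn: "\<And>y. \<forall>i. 0 \<le> y $ i \<Longrightarrow> 0 \<le> f y"
  shows "c \<le> (f v :: real)"
proof -
  have "newton_polyhedron E \<subseteq> f -` {c..}"
    unfolding newton_polyhedron_def
  proof (rule hull_minimal)
    show "(\<Union>x\<in>E. (\<lambda>y. x + y) ` {y. \<forall>i. 0 \<le> y $ i}) \<subseteq> f -` {c..}"
      using E nn by (fastforce simp: linear_add[OF f] intro: add_increasing2)
    show "convex (f -` {c..})" by (intro convex_linear_vimage f) simp
  qed
  then show ?thesis using v by auto
qed

lemma coordinate_permutations_permute:
  assumes "w \<in> coordinate_permutations v" "p permutes UNIV"
  shows "(\<chi> i. w $ p i) \<in> coordinate_permutations v"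
proof -
  obtain q where "q permutes UNIV" "w = (\<chi> i. v $ q i)"
    using assms(1) by (auto simp: coordinate_permutations_def)
  then show ?thesis
    unfolding coordinate_permutations_def using permutes_compose[OF assms(2)]
    by (intro CollectI exI[of _ "q \<circ> p"]) simp
qed

text \<open>The exceptional case of majorization is stated with multisets. The swaps of coordinates
  1, 2 and 2, 3 generate all arrangements of three entries.\<close>

lemma mset_eq_imp_coordinate_permutation:
  assumes "{#x, y, z#} = {#x', y', z'#}"
  shows "(vector [x, y, z] :: 'a::zero ^ 3) \<in> coordinate_permutations (vector [x', y', z'])"
proof -
  define E where "E x y z \<longleftrightarrow> (vector [x, y, z] :: 'a ^ 3) \<in> coordinate_permutations (vector [x', y', z'])" for x y z
  have "(\<chi> i. (vector [x', y', z'] :: 'a ^ 3) $ id i) \<in> coordinate_permutations (vector [x', y', z'])"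
    unfolding coordinate_permutations_def using permutes_id by blast
  then have refl: "E x' y' z'" by (simp add: E_def)
  have swap: "E x y z \<longleftrightarrow> E y x z" "E x y z \<longleftrightarrow> E x z y" for x y z
  proof -
    have 12: "(\<chi> i. (vector [x, y, z] :: 'a ^ 3) $ Transposition.transpose 1 2 i) = vector [y, x, z]"
      and 23: "(\<chi> i. (vector [x, y, z] :: 'a ^ 3) $ Transposition.transpose 2 3 i) = vector [x, z, y]" for x y z
      by (simp_all add: vec_eq_iff forall_3 Transposition.transpose_def)
    have "E x y z \<Longrightarrow> E y x z" for x y z
      unfolding E_def using coordinate_permutations_permute[OF _ permutes_swap_id[OF UNIV_I UNIV_I]] 12 by metis
    moreover have "E x y z \<Longrightarrow> E x z y" for x y z
      unfolding E_def using coordinate_permutations_permute[OF _ permutes_swap_id[OF UNIV_I UNIV_I]] 23 by metis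
    ultimately show "E x y z \<longleftrightarrow> E y x z" "E x y z \<longleftrightarrow> E x z y" by blast+
  qed
  have "E x y z"
    using assms refl swap by (auto simp: add_eq_conv_ex)
  then show ?thesis by (simp add: E_def)
qed

text \<open>Single coordinates, sums of two and the total are linear forms that are nonnegative on
  the orthant, so checking them at the permuted vertices suffices.\<close>

lemma newton_polyhedron_majorized:
  fixes b :: "real ^ 3"
  assumes b: "b \<in> newton_polyhedron (coordinate_permutations (vector [A, m, M]))"
    and A: "A \<le> m" "A \<le> M"
  shows "A \<le> b $ i" and "i \<noteq> j \<Longrightarrow> A + min m M \<le> b $ i + b $ j" and "A + m + M \<le> b $ 1 + b $ 2 + b $ 3"
proof -
  let ?v = "vector [A, m, M] :: real ^ 3"
  have lin: "linear (\<lambda>v :: real ^ 3. v $ i)" "linear (\<lambda>v :: real ^ 3. v $ i + v $ j)"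
    "linear (\<lambda>v :: real ^ 3. v $ 1 + v $ 2 + v $ 3)" for i j
    by (auto intro!: linearI simp: algebra_simps)
  have v1: "A \<le> ?v $ k" for k using exhaust_3[of k] A by auto
  have v2: "A + min m M \<le> ?v $ k + ?v $ l" if "k \<noteq> l" for k l
    using exhaust_3[of k] exhaust_3[of l] A that by auto
  have v3: "?v $ p 1 + ?v $ p 2 + ?v $ p 3 = A + m + M" if "p permutes UNIV" for p
    using sum.permute[OF that, of "\<lambda>i. ?v $ i"] by (simp add: sum_3)
  show "A \<le> b $ i"
    by (rule newton_polyhedron_lower_bound[OF b lin(1)]) (auto simp: coordinate_permutations_def v1)
  show "A + min m M \<le> b $ i + b $ j" if "i \<noteq> j"
    by (rule newton_polyhedron_lower_bound[OF b lin(2)])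
      (use that in \<open>auto simp: coordinate_permutations_def inj_eq[OF permutes_inj] intro!: v2\<close>)
  show "A + m + M \<le> b $ 1 + b $ 2 + b $ 3"
    by (rule newton_polyhedron_lower_bound[OF b lin(3)]) (auto simp: coordinate_permutations_def v3)
qed

theorem theorem6p2:
  fixes a1 a2 b1 b2 b3 :: real
  assumes "0 < a1" and "a1 < a2"
    and "(vector [b1, b2, b3] :: real ^ 3)
           \<in> newton_polyhedron (coordinate_permutations (vector [a1, a2 + 1/2, 2 * a2]))"
  shows "(\<forall>x>0. hypergeo [a1, a2] [b1, b2, b3] (- (x ^ 2)) \<ge> 0) \<and>
    ((vector [b1, b2, b3] :: real ^ 3)
         \<notin> coordinate_permutations (vector [a1, a2 + 1/2, 2 * a2])
       \<longrightarrow> (\<forall>x>0. hypergeo [a1, a2] [b1, b2, b3] (- (x ^ 2)) > 0))"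
proof -
  define u where "u n = pochhammer a1 n * pochhammer a2 n / fact n" for n
  define c where "c n = u n / (pochhammer b1 n * pochhammer b2 n * pochhammer b3 n)" for n
  \<comment> \<open>The order of \<open>a2 + 1/2\<close> and \<open>2 * a2\<close> depends on
    whether \<open>a2\<close> exceeds 1/2, while majorization expects sorted parameters.\<close>
  define m where "m = min (a2 + 1/2) (2 * a2)"
  define M where "M = max (a2 + 1/2) (2 * a2)"
  have hyp: "hypergeo [a1, a2] [b1, b2, b3] z = (\<Sum>n. c n * z ^ n)" for z
    by (simp add: hypergeo_2_3 c_def u_def mult.assoc)
  have mM: "{#a1, m, M#} = {#a1, a2 + 1/2, 2 * a2#}"
    by (auto simp: m_def M_def min_def max_def add_mset_commute)
  have vertex: "u n / (pochhammer a1 n * pochhammer m n * pochhammer M n)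
      = pochhammer a2 n / (fact n * pochhammer (a2 + 1/2) n * pochhammer (2 * a2) n)" for n
  proof -
    have "pochhammer a1 n > 0" using assms(1) by (rule pochhammer_pos)
    moreover have "pochhammer m n * pochhammer M n = pochhammer (a2 + 1/2) n * pochhammer (2 * a2) n"
      by (simp add: m_def M_def min_def max_def)
    ultimately show ?thesis by (simp add: u_def mult.assoc)
  qed
  have "a2 > 0" using assms by simp
  note square = sums_square_0F1[OF this]
  have nn: "nonneg_series (\<lambda>n. u n / (pochhammer a1 n * pochhammer m n * pochhammer M n))"
    unfolding vertex nonneg_series_def
    using sums_summable[OF square] sums_unique[OF square, symmetric] by simp
  have A: "a1 \<le> m" "m \<le> M" using assms by (auto simp: m_def M_def)
  have A': "a1 \<le> a2 + 1/2" "a1 \<le> 2 * a2" using assms by auto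
  note maj = newton_polyhedron_majorized[OF assms(3) A']
  have mM_sum: "m + M = a2 + 1/2 + 2 * a2" by (simp add: m_def M_def min_def max_def)
  have "pos_series c \<or> {#b1, b2, b3#} = {#a1, m, M#}"
    unfolding c_def
  proof (rule pos_series_majorized[OF assms(1) A nn])
    show "a1 \<le> b1" "a1 \<le> b2" "a1 \<le> b3" using maj(1)[of 1] maj(1)[of 2] maj(1)[of 3] by simp_all
    show "a1 + m \<le> b1 + b2" "a1 + m \<le> b1 + b3" "a1 + m \<le> b2 + b3"
      using maj(2)[of 1 2] maj(2)[of 1 3] maj(2)[of 2 3] by (simp_all add: m_def)
    show "a1 + m + M \<le> b1 + b2 + b3" using maj(3) mM_sum by simp
  qed
  then show ?thesis
  proof
    assume "pos_series c"
    then have "0 < hypergeo [a1, a2] [b1, b2, b3] (- (x ^ 2))" for x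
      by (simp add: hyp pos_series_def)
    then show ?thesis by (simp add: less_imp_le)
  next
    assume eq: "{#b1, b2, b3#} = {#a1, m, M#}"
    \<comment> \<open>Written as a product over a multiset, the denominator can be rewritten by
      \<open>eq\<close> without tracking the order of the parameters.\<close>
    have "c n = u n / (\<Prod>b\<in>#{#b1, b2, b3#}. pochhammer b n)" for n
      by (simp add: c_def mult.assoc)
    then have "c = (\<lambda>n. u n / (pochhammer a1 n * pochhammer m n * pochhammer M n))"
      unfolding eq by (simp add: fun_eq_iff mult.assoc)
    then have "nonneg_series c" using nn by simp
    then have "0 \<le> hypergeo [a1, a2] [b1, b2, b3] (- (x ^ 2))" for x
      by (simp add: hyp nonneg_series_def)
    \<comment> \<open>Here the point is a vertex, so the strict claim is vacuous.\<close>
    moreover have "(vector [b1, b2, b3] :: real ^ 3) \<in> coordinate_permutations (vector [a1, a2 + 1/2, 2 * a2])"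
      by (rule mset_eq_imp_coordinate_permutation) (simp only: eq mM)
    ultimately show ?thesis by blast
  qed
qed

end
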